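(* Consider the BDF2–Chang–Cooper scheme $$(3I-2\,\delta t\,A)f^{m+1}=4f^m-f^{m-1}+\delta t\,Q(f^m;\bar\alpha)$$ on the periodic grid. Provided that $\sum_{i=1}^N f_i^m=\sum_{i=1}^N f_i^{m-1}$, the scheme is conservative: $\sum_{i=1}^N f_i^{m+1}=\sum_{i=1}^N f_i^{m}$.
   Context: Setting. $\Omega=[\Omega_a,\Omega_b]$ is an interval with its end points identified (a torus). $b\in\mathbb{R}$, $\sigma^2>0$, $B=-b$, $C=\sigma^2/2>0$, $\delta t>0$. The space grid is $x_i=\Omega_a+ih$, $i=0,\dots,N$, $h=(\Omega_b-\Omega_a)/N$, $N\ge 3$; since $x_0$ and $x_N$ are identified, grid functions are vectors $f=(f_1,\dots,f_N)^\top\in\mathbb{R}^N$ with indices read modulo $N$. Matrix $A$ (Chang–Cooper discretization of $f\mapsto\partial_x(Bf+C\partial_x f)$): let $\omega=\exp(hB/C)$ and $\beta=B/(\omega-1)$ (with $\beta=C/h$ if $B=0$), so $\beta>0$. $A\in\mathbb{R}^{N\times N}$ has entries $A_{i,i}=-\beta(1+\omega)/h$, $A_{i,i-1}=\beta/h$, $A_{i,i+1}=\omega\beta/h$, $A_{1,N}=\beta/h$, $A_{N,1}=\omega\beta/h$, and all other entries $0$. Jump term: $\bar\alpha=(\alpha_1,\dots,\alpha_{N_\Theta})$ with $\alpha_j\ge0$. $\Delta=(\Omega_b-\Omega_a)/N_\Theta$, $\theta_j=\Omega_a+\Delta(j-1)$, and $\Theta_j$ is the hat function on the torus $\Theta_j(s)=1+(s-\theta_j)/\Delta$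 on $[\theta_j-\Delta,\theta_j]$, $\Theta_j(s)=1-(s-\theta_j)/\Delta$ on $[\theta_j,\theta_j+\Delta]$, zero elsewhere (extended periodically, $\Theta_1\equiv\Theta_{N_\Theta+1}$). With $s_k=x_k$, put $\theta_{jk}=\Theta_j(s_k)\ge0$. For a grid function $f$, $\hat f_{ik}$ is $f$ translated by $s_k$ and continued by periodicity, i.e. $\hat f_{ik}=f_{i+\sigma_k}$ (index mod $N$), where the integer $\sigma_k$ is the number of grid cells of the translation by $s_k$ ($\sigma_k=s_k/h$ when $0$ is a grid point; the result does not depend on which integers $\sigma_k$ are used). Then $Q(f;\bar\alpha)\in\mathbb{R}^N$ is given by $$Q(f;\bar\alpha)_i=h\sum_{j=1}^{N_\Theta}\alpha_j\sum_{k=1}^N\hat f_{ik}\,\theta_{jk}-a f_i,\qquad a=h\sum_{j=1}^{N_\Theta}\alpha_j\sum_{k=1}^N\theta_{jk}.$$ *)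

theory Defs
  imports Complex_Main "Jordan_Normal_Form.Matrix"
begin

definition mesh :: "real \<Rightarrow> real \<Rightarrow> nat \<Rightarrow> real" where
  "mesh \<Omega>a \<Omega>b N = (\<Omega>b - \<Omega>a) / real N"

definition grid_pt :: "real \<Rightarrow> real \<Rightarrow> nat \<Rightarrow> nat \<Rightarrow> real" where
  "grid_pt \<Omega>a \<Omega>b N i = \<Omega>a + real i * mesh \<Omega>a \<Omega>b N"

text \<open>A grid function \<open>(f\<^sub>1, \<dots>, f\<^sub>N)\<close> is a vector of dimension \<open>N\<close>; as vectors are
  indexed from \<open>0\<close>, the value \<open>f\<^sub>i\<close> is stored at position \<open>i - 1\<close>. The following
  reads the index modulo \<open>N\<close>.\<close>

definition gval :: "real vec \<Rightarrow> int \<Rightarrow> real" where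
  "gval f i = f $ nat ((i - 1) mod int (dim_vec f))"

definition cc_omega :: "real \<Rightarrow> real \<Rightarrow> real \<Rightarrow> real" where
  "cc_omega h B C = exp (h * B / C)"

definition cc_beta :: "real \<Rightarrow> real \<Rightarrow> real \<Rightarrow> real" where
  "cc_beta h B C = (if B = 0 then C / h else B / (cc_omega h B C - 1))"

text \<open>Entries with row and column indices in \<open>{1..N}\<close>.\<close>

definition cc_entry :: "nat \<Rightarrow> real \<Rightarrow> real \<Rightarrow> real \<Rightarrow> nat \<Rightarrow> nat \<Rightarrow> real" where
  "cc_entry N h B C i j =
    (let \<omega> = cc_omega h B C; \<beta> = cc_beta h B C in
     if j = i then - \<beta> * (1 + \<omega>) / h
     else if i = j + 1 then \<beta> / h
     else if j = i + 1 then \<omega> * \<beta> / h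
     else if i = 1 \<and> j = N then \<beta> / h
     else if i = N \<and> j = 1 then \<omega> * \<beta> / h
     else 0)"

definition cc_matrix :: "real \<Rightarrow> real \<Rightarrow> nat \<Rightarrow> real \<Rightarrow> real \<Rightarrow> real mat" where
  "cc_matrix \<Omega>a \<Omega>b N b \<sigma> =
    mat N N (\<lambda>(r, c). cc_entry N (mesh \<Omega>a \<Omega>b N) (- b) (\<sigma>\<^sup>2 / 2) (r + 1) (c + 1))"

definition hat_width :: "real \<Rightarrow> real \<Rightarrow> nat \<Rightarrow> real" where
  "hat_width \<Omega>a \<Omega>b M = (\<Omega>b - \<Omega>a) / real M"

definition hat_node :: "real \<Rightarrow> real \<Rightarrow> nat \<Rightarrow> nat \<Rightarrow> real" where
  "hat_node \<Omega>a \<Omega>b M j = \<Omega>a + hat_width \<Omega>a \<Omega>b M * (real j - 1)"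

text \<open>The representative, modulo the period \<open>L\<close>, of \<open>s\<close> in \<open>[c - L/2, c + L/2)\<close>.\<close>

definition torus_rep :: "real \<Rightarrow> real \<Rightarrow> real \<Rightarrow> real" where
  "torus_rep L c s = s - L * of_int \<lfloor>(s - c + L / 2) / L\<rfloor>"

text \<open>For \<open>M \<ge> 2\<close> the support \<open>[\<theta> - \<Delta>, \<theta> + \<Delta>]\<close> of a hat has length at most one
  period, so evaluating at the representative around the node is the periodic extension.\<close>

definition hat_fun :: "real \<Rightarrow> real \<Rightarrow> nat \<Rightarrow> nat \<Rightarrow> real \<Rightarrow> real" where
  "hat_fun \<Omega>a \<Omega>b M j s =
    (let \<Delta> = hat_width \<Omega>a \<Omega>b M; \<theta> = hat_node \<Omega>a \<Omega>b M j; t = torus_rep (\<Omega>b - \<Omega>a) \<theta> s in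
     if \<theta> - \<Delta> \<le> t \<and> t \<le> \<theta> then 1 + (t - \<theta>) / \<Delta>
     else if \<theta> \<le> t \<and> t \<le> \<theta> + \<Delta> then 1 - (t - \<theta>) / \<Delta>
     else 0)"

definition hat_at :: "real \<Rightarrow> real \<Rightarrow> nat \<Rightarrow> nat \<Rightarrow> nat \<Rightarrow> nat \<Rightarrow> real" where
  "hat_at \<Omega>a \<Omega>b N M j k = hat_fun \<Omega>a \<Omega>b M j (grid_pt \<Omega>a \<Omega>b N k)"

text \<open>\<open>n\<close> cells realise the translation by \<open>s\<close> on the torus, i.e. modulo the period.
  A translation by a non-multiple of the mesh size does not map the grid to itself; then
  the number of cells is a matter of convention and every integer is admitted.\<close>

definition cell_shift :: "real \<Rightarrow> real \<Rightarrow> nat \<Rightarrow> real \<Rightarrow> int \<Rightarrow> bool" where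
  "cell_shift \<Omega>a \<Omega>b N s n \<longleftrightarrow>
    (s / mesh \<Omega>a \<Omega>b N \<in> \<int> \<longrightarrow>
      (\<exists>m::int. of_int n * mesh \<Omega>a \<Omega>b N = s + of_int m * (\<Omega>b - \<Omega>a)))"

definition jump_rate :: "real \<Rightarrow> real \<Rightarrow> nat \<Rightarrow> nat \<Rightarrow> (nat \<Rightarrow> real) \<Rightarrow> real" where
  "jump_rate \<Omega>a \<Omega>b N M \<alpha> =
    mesh \<Omega>a \<Omega>b N * (\<Sum>j=1..M. \<alpha> j * (\<Sum>k=1..N. hat_at \<Omega>a \<Omega>b N M j k))"

definition jump_term ::
  "real \<Rightarrow> real \<Rightarrow> nat \<Rightarrow> nat \<Rightarrow> (nat \<Rightarrow> int) \<Rightarrow> (nat \<Rightarrow> real) \<Rightarrow> real vec \<Rightarrow> real vec" where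
  "jump_term \<Omega>a \<Omega>b N M n \<alpha> f =
    vec N (\<lambda>r. let i = int r + 1 in
      mesh \<Omega>a \<Omega>b N *
        (\<Sum>j=1..M. \<alpha> j * (\<Sum>k=1..N. gval f (i + n k) * hat_at \<Omega>a \<Omega>b N M j k))
      - jump_rate \<Omega>a \<Omega>b N M \<alpha> * gval f i)"

end

theory Submission imports Defs begin

text \<open>
  Summing the components of the scheme over the torus annihilates both operators. The matrix
  \<open>A\<close> discretizes a flux in divergence form, so the flux leaving one cell enters its neighbour:
  the columns of \<open>A\<close> sum to zero (\<open>cc_entry_column_sum\<close>), and hence so do the components of
  \<open>A f\<close> (\<open>vec_sum_mult_mat_vec_eq_0\<close>). In \<open>Q f\<close> every translate of \<open>f\<close> has the same sum as \<open>f\<close>,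
  because a translation permutes the torus (\<open>sum_gval_shift\<close>); the gain term therefore sums to
  the jump rate \<open>a\<close> times the sum of \<open>f\<close>, which is what the loss term removes
  (\<open>vec_sum_jump_term\<close>).

  Writing \<open>S\<^sub>l\<close> for the sum of \<open>f\<^sup>l\<close>, what remains of the scheme is the scalar recursion
  \<open>3 S\<^sub>m\<^sub>+\<^sub>1 = 4 S\<^sub>m - S\<^sub>m\<^sub>-\<^sub>1\<close>, and \<open>S\<^sub>m = S\<^sub>m\<^sub>-\<^sub>1\<close> turns it into \<open>S\<^sub>m\<^sub>+\<^sub>1 = S\<^sub>m\<close>.
\<close>

definition vec_sum :: "real vec \<Rightarrow> real" where
  "vec_sum u = (\<Sum>r<dim_vec u. u $ r)"

lemma sum_atLeast1_atMost_shift: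
  fixes g :: "nat \<Rightarrow> 'a::comm_monoid_add"
  shows "(\<Sum>i=1..N. g i) = (\<Sum>r<N. g (r + 1))"
  using sum.shift_bounds_cl_Suc_ivl[of g 0 "N - 1"]
  by (cases N) (simp_all add: lessThan_Suc_atMost atMost_atLeast0)

lemma gval_Suc:
  assumes "u \<in> carrier_vec N" and "r < N"
  shows "gval u (int r + 1) = u $ r"
  using assms by (simp add: gval_def)

lemma vec_sum_eq_sum_gval:
  assumes "u \<in> carrier_vec N"
  shows "(\<Sum>i=1..N. gval u (int i)) = vec_sum u"
proof -
  have "(\<Sum>i=1..N. gval u (int i)) = (\<Sum>r<N. gval u (int r + 1))"
    by (simp only: sum_atLeast1_atMost_shift of_nat_add of_nat_1)
  also have "\<dots> = (\<Sum>r<N. u $ r)"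
    by (rule sum.cong) (simp_all add: gval_Suc[OF assms])
  finally show ?thesis
    using assms by (simp add: vec_sum_def)
qed

lemma bij_betw_add_mod:
  fixes N :: nat and k :: int
  assumes "N > 0"
  shows "bij_betw (\<lambda>r. nat ((int r + k) mod int N)) {..<N} {..<N}"
proof -
  let ?p = "\<lambda>r. nat ((int r + k) mod int N)"
  have maps: "?p ` {..<N} \<subseteq> {..<N}"
    using assms by (auto simp: nat_less_iff)
  have inj: "inj_on ?p {..<N}"
  proof (rule inj_onI)
    fix r s assume rs: "r \<in> {..<N}" "s \<in> {..<N}" and eq: "?p r = ?p s"
    have "(int r + k) mod int N = (int s + k) mod int N"
      using eq assms by (simp add: eq_nat_nat_iff)
    then have "((int r + k) - k) mod int N = ((int s + k) - k) mod int N"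
      by (rule mod_diff_cong) simp
    then show "r = s" using rs by simp
  qed
  show ?thesis
    using endo_inj_surj[OF finite_lessThan maps inj] inj by (simp add: bij_betw_def)
qed

text \<open>Conservation by the jump term rests on this: adding an integer modulo \<open>N\<close> permutes the grid.\<close>

lemma sum_gval_shift:
  assumes u: "u \<in> carrier_vec N"
  shows "(\<Sum>r<N. gval u (int r + 1 + k)) = vec_sum u"
proof (cases "N = 0")
  case True
  then show ?thesis using u by (simp add: vec_sum_def)
next
  case False
  have "(\<Sum>r<N. gval u (int r + 1 + k)) = (\<Sum>r<N. u $ nat ((int r + k) mod int N))"
    using u by (simp add: gval_def algebra_simps)
  also have "\<dots> = (\<Sum>r<N. u $ r)"
    using False by (intro sum.reindex_bij_betw bij_betw_add_mod) simp
  finally show ?thesis using u by (simp add: vec_sum_def)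
qed

text \<open>Column \<open>j\<close> has three nonzero entries, in the row \<open>j\<close> and in its two cyclic neighbours;
  these rows are distinct since \<open>N \<ge> 3\<close>, and the two neighbouring entries \<open>\<beta>/h\<close> and \<open>\<omega>\<beta>/h\<close>
  cancel the diagonal one.\<close>

lemma cc_entry_column_sum:
  assumes N: "N \<ge> 3" and j: "j \<in> {1..N}"
  shows "(\<Sum>i=1..N. cc_entry N h B C i j) = 0"
proof -
  define \<omega> where "\<omega> = cc_omega h B C"
  define \<beta> where "\<beta> = cc_beta h B C"
  define s where "s = (if j = N then 1 else j + 1)"
  define p where "p = (if j = 1 then N else j - 1)"
  have sp: "s \<in> {1..N}" "p \<in> {1..N}"
    using N j by (auto simp: s_def p_def)
  have "(\<Sum>i=1..N. cc_entry N h B C i j) =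
      (\<Sum>i=1..N. (if i = j then - \<beta> * (1 + \<omega>) / h else 0)
        + (if i = s then \<beta> / h else 0) + (if i = p then \<omega> * \<beta> / h else 0))"
  proof (rule sum.cong)
    fix i assume "i \<in> {1..N}"
    then show "cc_entry N h B C i j = (if i = j then - \<beta> * (1 + \<omega>) / h else 0)
        + (if i = s then \<beta> / h else 0) + (if i = p then \<omega> * \<beta> / h else 0)"
      using N j unfolding cc_entry_def Let_def \<omega>_def[symmetric] \<beta>_def[symmetric] s_def p_def
      by auto
  qed simp
  also have "\<dots> = - \<beta> * (1 + \<omega>) / h + \<beta> / h + \<omega> * \<beta> / h"
    using j sp by (simp add: sum.distrib)
  also have "\<dots> = (- \<beta> * (1 + \<omega>) + \<beta> + \<omega> * \<beta>) / h"
    by (simp only: add_divide_distrib)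
  also have "\<dots> = 0"
    by (simp add: algebra_simps)
  finally show ?thesis .
qed

lemma cc_matrix_column_sum:
  assumes "N \<ge> 3" and "c < N"
  shows "(\<Sum>r<N. cc_matrix \<Omega>a \<Omega>b N b \<sigma> $$ (r, c)) = 0"
proof -
  have "(\<Sum>r<N. cc_matrix \<Omega>a \<Omega>b N b \<sigma> $$ (r, c)) =
      (\<Sum>i=1..N. cc_entry N (mesh \<Omega>a \<Omega>b N) (- b) (\<sigma>\<^sup>2 / 2) i (c + 1))"
    using assms(2) unfolding sum_atLeast1_atMost_shift by (simp add: cc_matrix_def)
  then show ?thesis
    using cc_entry_column_sum[of N "c + 1"] assms by simp
qed

lemma vec_sum_mult_mat_vec_eq_0:
  assumes A: "A \<in> carrier_mat N N" and u: "u \<in> carrier_vec N"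
    and col: "\<And>c. c < N \<Longrightarrow> (\<Sum>r<N. A $$ (r, c)) = 0"
  shows "vec_sum (A *\<^sub>v u) = 0"
proof -
  have "vec_sum (A *\<^sub>v u) = (\<Sum>r<N. \<Sum>c<N. A $$ (r, c) * u $ c)"
    using A u by (simp add: vec_sum_def scalar_prod_def lessThan_atLeast0)
  also have "\<dots> = (\<Sum>c<N. (\<Sum>r<N. A $$ (r, c)) * u $ c)"
    by (subst sum.swap) (simp add: sum_distrib_right)
  also have "\<dots> = 0"
    using col by simp
  finally show ?thesis .
qed

lemma smult_mat_mult_vec:
  fixes k :: "'a::comm_ring"
  assumes "A \<in> carrier_mat nr nc" and "v \<in> carrier_vec nc"
  shows "(k \<cdot>\<^sub>m A) *\<^sub>v v = k \<cdot>\<^sub>v (A *\<^sub>v v)"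
  using assms by (intro eq_vecI) (auto simp: scalar_prod_def sum_distrib_left mult.assoc)

text \<open>Exchanging sums puts the sum over the grid innermost, where each translate contributes
  the sum of \<open>u\<close>; the common factor left over is the jump rate.\<close>

lemma vec_sum_jump_term:
  assumes u: "u \<in> carrier_vec N"
  shows "vec_sum (jump_term \<Omega>a \<Omega>b N M n \<alpha> u) = 0"
proof -
  let ?h = "mesh \<Omega>a \<Omega>b N" and ?\<theta> = "hat_at \<Omega>a \<Omega>b N M" and ?a = "jump_rate \<Omega>a \<Omega>b N M \<alpha>"
  have "(\<Sum>r<N. \<Sum>j=1..M. \<alpha> j * (\<Sum>k=1..N. gval u (int r + 1 + n k) * ?\<theta> j k))
      = (\<Sum>j=1..M. \<Sum>r<N. \<alpha> j * (\<Sum>k=1..N. gval u (int r + 1 + n k) * ?\<theta> j k))"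
    by (rule sum.swap)
  also have "\<dots> = (\<Sum>j=1..M. \<alpha> j * (\<Sum>k=1..N. (\<Sum>r<N. gval u (int r + 1 + n k)) * ?\<theta> j k))"
    unfolding sum_distrib_left[symmetric] sum_distrib_right
    by (subst sum.swap) (rule refl)
  also have "\<dots> = (\<Sum>j=1..M. \<alpha> j * (\<Sum>k=1..N. ?\<theta> j k)) * vec_sum u"
    unfolding sum_gval_shift[OF u]
    by (simp add: sum_distrib_left[symmetric] sum_distrib_right algebra_simps)
  finally have gain: "(\<Sum>r<N. ?h * (\<Sum>j=1..M. \<alpha> j *
      (\<Sum>k=1..N. gval u (int r + 1 + n k) * ?\<theta> j k))) = ?a * vec_sum u"
    by (simp add: sum_distrib_left[symmetric] jump_rate_def)
  have loss: "(\<Sum>r<N. ?a * gval u (int r + 1)) = ?a * vec_sum u"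
    using sum_gval_shift[OF u, of 0] by (simp add: sum_distrib_left[symmetric])
  have "vec_sum (jump_term \<Omega>a \<Omega>b N M n \<alpha> u) =
      (\<Sum>r<N. ?h * (\<Sum>j=1..M. \<alpha> j * (\<Sum>k=1..N. gval u (int r + 1 + n k) * ?\<theta> j k))
        - ?a * gval u (int r + 1))"
    by (simp add: vec_sum_def jump_term_def Let_def)
  also have "\<dots> = 0"
    unfolding sum_subtractf gain loss by simp
  finally show ?thesis .
qed

theorem mainTheorem6:
  fixes \<Omega>a \<Omega>b b \<sigma> \<delta>t :: real
    and N M m :: nat
    and \<alpha> :: "nat \<Rightarrow> real"
    and n :: "nat \<Rightarrow> int"
    and f :: "nat \<Rightarrow> real vec"
  assumes "\<Omega>a < \<Omega>b" and "\<sigma>\<^sup>2 > 0" and "\<delta>t > 0" and "N \<ge> 3" and "M \<ge> 1"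
    and "\<And>j. j \<in> {1..M} \<Longrightarrow> \<alpha> j \<ge> 0"
    and "\<And>k. k \<in> {1..N} \<Longrightarrow> cell_shift \<Omega>a \<Omega>b N (grid_pt \<Omega>a \<Omega>b N k) (n k)"
    and "\<And>l. f l \<in> carrier_vec N"
    and "m \<ge> 1"
    and scheme: "(3 \<cdot>\<^sub>m 1\<^sub>m N - (2 * \<delta>t) \<cdot>\<^sub>m cc_matrix \<Omega>a \<Omega>b N b \<sigma>) *\<^sub>v f (m + 1)
      = 4 \<cdot>\<^sub>v f m - f (m - 1) + \<delta>t \<cdot>\<^sub>v jump_term \<Omega>a \<Omega>b N M n \<alpha> (f m)"
    and "(\<Sum>i=1..N. gval (f m) (int i)) = (\<Sum>i=1..N. gval (f (m - 1)) (int i))"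
  shows "(\<Sum>i=1..N. gval (f (m + 1)) (int i)) = (\<Sum>i=1..N. gval (f m) (int i))"
proof -
  let ?A = "cc_matrix \<Omega>a \<Omega>b N b \<sigma>" and ?Q = "jump_term \<Omega>a \<Omega>b N M n \<alpha> (f m)"
  have f: "f l \<in> carrier_vec N" for l
    by fact
  have A: "?A \<in> carrier_mat N N"
    by (simp add: cc_matrix_def)
  have Q: "?Q \<in> carrier_vec N"
    by (simp add: jump_term_def)
  have dims: "dim_vec (f l) = N" "dim_vec (?A *\<^sub>v f l) = N" "dim_vec ?Q = N" for l
    using f[of l] A Q by auto
  have "(3 \<cdot>\<^sub>m 1\<^sub>m N - (2 * \<delta>t) \<cdot>\<^sub>m ?A) *\<^sub>v f (m + 1)
      = 3 \<cdot>\<^sub>v f (m + 1) - (2 * \<delta>t) \<cdot>\<^sub>v (?A *\<^sub>v f (m + 1))"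
    using A f[of "m + 1"]
    by (simp add: minus_mult_distrib_mat_vec[of _ N N] smult_mat_mult_vec[of _ N N])
  then have "vec_sum (3 \<cdot>\<^sub>v f (m + 1) - (2 * \<delta>t) \<cdot>\<^sub>v (?A *\<^sub>v f (m + 1)))
      = vec_sum (4 \<cdot>\<^sub>v f m - f (m - 1) + \<delta>t \<cdot>\<^sub>v ?Q)"
    using scheme by simp
  then have "3 * vec_sum (f (m + 1)) - 2 * \<delta>t * vec_sum (?A *\<^sub>v f (m + 1))
      = 4 * vec_sum (f m) - vec_sum (f (m - 1)) + \<delta>t * vec_sum ?Q"
    using dims
    by (simp add: vec_sum_def sum.distrib sum_subtractf sum_distrib_left[symmetric] del: index_mult_mat_vec)
  moreover have "vec_sum (?A *\<^sub>v f (m + 1)) = 0"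
    using A f cc_matrix_column_sum[OF \<open>N \<ge> 3\<close>] by (rule vec_sum_mult_mat_vec_eq_0)
  moreover have "vec_sum ?Q = 0"
    using f by (rule vec_sum_jump_term)
  moreover have "vec_sum (f m) = vec_sum (f (m - 1))"
    using assms(11) unfolding vec_sum_eq_sum_gval[OF f] .
  ultimately show ?thesis
    unfolding vec_sum_eq_sum_gval[OF f] by simp
qed

end
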